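(* Let $s\ge2$ and $A=\{\alpha_1,\dots,\alpha_s\}$. Let $L^\infty=A^\star\alpha_1^\omega\cup\dots\cup A^\star\alpha_s^\omega$ be the (countable) set of infinite words over $A$ that are eventually constant. Let $T^\infty:\mathbb{N}\times\mathbb{N}\to A$ be an infinite tableau whose rows are the elements of $L^\infty$, each listed once. Then: (1) $T^\infty$ is Cantorian, i.e. $\mathrm{Perm}(T^\infty)\cap L^\infty=\emptyset$; (2) if $s=2$, then $T^\infty$ is not bi-Cantorian, i.e. $\mathrm{Perm}(T^\infty)\cap(C^\omega\cup L^\infty)\neq\emptyset$, where $C^\omega$ is the set of column-words of $T^\infty$.
   Context: For an infinite tableau $T=(a_i^j)$ with row index $i\in\mathbb{N}$ and column index $j\in\mathbb{N}$, the permanent is the set of infinite words $\mathrm{Perm}(T)=\{a^1_{\pi(1)}a^2_{\pi(2)}a^3_{\pi(3)}\cdots:\pi:\mathbb{N}\to\mathbb{N}\text{ bijective}\}$. A tableau is Cantorian if its permanent is disjoint from its set of row-words. It is bi-Cantorian if its permanent is disjoint from the union of its set of row-words and its set of column-words. Here $u^\omega$ denotes the infinite repetition of $u$. *)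

theory Defs
  imports "HOL-Library.Omega_Words_Fun"
begin

text \<open>
  A tableau \<open>T\<close> has the entry \<open>T i j\<close> in row \<open>i\<close> and column \<open>j\<close>, both indexed
  from 0; the row-word of row \<open>i\<close> is \<open>T i\<close> itself.
\<close>

type_synonym 'a tableau = "nat \<Rightarrow> nat \<Rightarrow> 'a"

definition row_words :: "'a tableau \<Rightarrow> 'a word set" where
  "row_words T = {\<lambda>j. T i j | i. True}"

definition column_words :: "'a tableau \<Rightarrow> 'a word set" where
  "column_words T = {\<lambda>i. T i j | j. True}"

text \<open>
  In \<open>a\<^sup>j\<^sub>i\<close> the upper index is the column, so the \<open>j\<close>-th letter of a word of the permanent
  is taken from column \<open>j\<close> and row \<open>\<pi> j\<close>.
\<close>

definition Perm :: "'a tableau \<Rightarrow> 'a word set" where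
  "Perm T = {\<lambda>j. T (\<pi> j) j | \<pi>. bij \<pi>}"

definition cantorian :: "'a tableau \<Rightarrow> bool" where
  "cantorian T \<longleftrightarrow> Perm T \<inter> row_words T = {}"

definition bi_cantorian :: "'a tableau \<Rightarrow> bool" where
  "bi_cantorian T \<longleftrightarrow> Perm T \<inter> (row_words T \<union> column_words T) = {}"

definition L_inf :: "'a set \<Rightarrow> 'a word set" where
  "L_inf A = (\<Union>a\<in>A. {u \<frown> [a]\<^sup>\<omega> | u. u \<in> lists A})"

end

(*
  If a word w of the permanent were in L_inf A, applying a fixed-point-free map of A to each of
  its letters would give another word of L_inf A. That word is a row of the tableau and differs
  from w everywhere, but w uses some entry of every row.

  Every column-word c contains every letter infinitely often, so each row, being eventually
  constant, agrees with c at infinitely many positions; likewise each column j contains the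
  letter c j infinitely often. A Cantor-Bernstein argument then gives a bijection that chooses
  one agreeing position in each row and in each column, so that c lies in the permanent.
*)
theory Submission
  imports Defs
begin

text \<open>An infinite set of naturals always has an element beyond the previous choice. Strict
  growth is wanted because it makes the selection injective.\<close>

lemma strict_mono_choice:
  fixes S :: "nat \<Rightarrow> nat set"
  assumes "\<And>n. infinite (S n)"
  shows "\<exists>f. strict_mono f \<and> (\<forall>n. f n \<in> S n)"
proof -
  have "\<exists>f. \<forall>n. f n \<in> S n \<and> f n < f (Suc n)"
  proof (rule dependent_nat_choice)
    show "\<exists>x. x \<in> S 0"
      using assms[of 0] by (meson infinite_nat_iff_unbounded)
    show "\<exists>y. y \<in> S (Suc n) \<and> x < y" for x n
      using assms[of "Suc n"] by (meson infinite_nat_iff_unbounded)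
  qed
  then show ?thesis
    by (auto simp: strict_mono_Suc_iff)
qed

text \<open>Cantor-Bernstein, keeping track of the graph: each pair (x, h x) comes either from f or
  from g read backwards, and both kinds lie in R.\<close>

lemma bij_in_relation:
  assumes "inj f" "\<And>x. R x (f x)" and "inj g" "\<And>y. R (g y) y"
  shows "\<exists>h. bij h \<and> (\<forall>x. R x (h x))"
proof -
  \<comment> \<open>X is where h follows f. By the fixed-point equation, the points outside X are
    exactly the g-images of the points that f misses on X, so there h can go back along g. The two
    complements make the operator monotone.\<close>
  define X where "X = lfp (\<lambda>X. - g ` (- f ` X))"
  have X: "X = - g ` (- f ` X)"
    unfolding X_def by (rule lfp_unfold) (blast intro: monoI)
  define h where "h x = (if x \<in> X then f x else inv g x)" for x
  have outside: "\<exists>y. x = g y \<and> y \<notin> f ` X" if "x \<notin> X" for x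
    using that X by blast
  have h_out: "g (h x) = x \<and> h x \<notin> f ` X" if "x \<notin> X" for x
    using outside[OF that] that \<open>inj g\<close> by (auto simp: h_def)
  have h_in: "h x \<in> f ` X" if "x \<in> X" for x
    using that by (simp add: h_def)
  have "inj h"
  proof (rule injI)
    fix x y assume eq: "h x = h y"
    show "x = y"
    proof (cases "x \<in> X \<longleftrightarrow> y \<in> X")
      case True
      then show ?thesis
        using eq h_out[of x] h_out[of y] injD[OF \<open>inj f\<close>, of x y]
        by (cases "x \<in> X") (simp_all add: h_def)
    next
      \<comment> \<open>One of the two values lies in the image of X under f and the other outside
        it.\<close>
      case False
      then show ?thesis
        using eq h_out[of x] h_out[of y] h_in[of x] h_in[of y] by metis
    qed
  qed
  moreover have "y \<in> range h" for y
  proof (cases "y \<in> f ` X")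
    case True
    then show ?thesis by (auto simp: h_def)
  next
    case False
    then have "g y \<notin> X" using X by blast
    then have "h (g y) = y" using \<open>inj g\<close> by (simp add: h_def)
    then show ?thesis by (metis rangeI)
  qed
  moreover have "R x (h x)" for x
  proof (cases "x \<in> X")
    case True
    then show ?thesis using assms(2) by (simp add: h_def)
  next
    case False
    then show ?thesis using h_out[of x] assms(4)[of "h x"] by simp
  qed
  ultimately show ?thesis
    unfolding bij_def by blast
qed

lemma bij_in_infinite_relation:
  fixes R :: "nat \<Rightarrow> nat \<Rightarrow> bool"
  assumes "\<And>x. infinite {y. R x y}" and "\<And>y. infinite {x. R x y}"
  shows "\<exists>h. bij h \<and> (\<forall>x. R x (h x))"
proof -
  obtain f where f: "strict_mono f" "\<And>x. R x (f x)"
    using strict_mono_choice[of "\<lambda>x. {y. R x y}"] assms(1) by auto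
  obtain g where g: "strict_mono g" "\<And>y. R (g y) y"
    using strict_mono_choice[of "\<lambda>y. {x. R x y}"] assms(2) by auto
  show ?thesis
    by (rule bij_in_relation[of f _ g]) (use f g in \<open>auto intro: strict_mono_imp_inj_on\<close>)
qed

text \<open>A pointwise form, convenient for words given as functions. The eventual letter is a
  value of w, so the range condition already puts it in A.\<close>

lemma L_inf_iff:
  "w \<in> L_inf A \<longleftrightarrow> range w \<subseteq> A \<and> (\<exists>a N. \<forall>j\<ge>N. w j = a)"
proof
  assume "w \<in> L_inf A"
  then obtain a u where a: "a \<in> A" "u \<in> lists A" and w: "w = u \<frown> [a]\<^sup>\<omega>"
    by (auto simp: L_inf_def)
  have "range w \<subseteq> A"
    using a by (auto simp: w)
  moreover have "\<forall>j\<ge>length u. w j = a"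
    by (simp add: w)
  ultimately show "range w \<subseteq> A \<and> (\<exists>a N. \<forall>j\<ge>N. w j = a)"
    by blast
next
  assume "range w \<subseteq> A \<and> (\<exists>a N. \<forall>j\<ge>N. w j = a)"
  then obtain a N where wA: "range w \<subseteq> A" and tail: "\<And>j. j \<ge> N \<Longrightarrow> w j = a"
    by blast
  have "w = map w [0..<N] \<frown> [a]\<^sup>\<omega>"
    using tail by (auto simp: conc_def fun_eq_iff)
  moreover have "a \<in> A"
    using wA tail[of N] by auto
  moreover have "map w [0..<N] \<in> lists A"
    using wA by (auto simp: image_subset_iff)
  ultimately show "w \<in> L_inf A"
    unfolding L_inf_def by blast
qed

lemma row_words_eq_range: "row_words T = range T"
  by (auto simp: row_words_def)

lemma Perm_disjoint_L_inf:
  assumes A: "\<And>a. a \<in> A \<Longrightarrow> \<exists>b\<in>A. b \<noteq> a" and T: "L_inf A \<subseteq> range T"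
  shows "Perm T \<inter> L_inf A = {}"
proof (rule ccontr)
  assume "Perm T \<inter> L_inf A \<noteq> {}"
  then obtain \<pi> where \<pi>: "bij \<pi>" and w: "(\<lambda>j. T (\<pi> j) j) \<in> L_inf A"
    by (auto simp: Perm_def)
  define w where "w = (\<lambda>j. T (\<pi> j) j)"
  obtain a N where wA: "range w \<subseteq> A" and tail: "\<And>j. j \<ge> N \<Longrightarrow> w j = a"
    using w unfolding w_def[symmetric] L_inf_iff by blast
  obtain d where d: "\<And>a. a \<in> A \<Longrightarrow> d a \<in> A \<and> d a \<noteq> a"
    using A by metis
  \<comment> \<open>From position N on, this word is constantly \<open>d a\<close>.\<close>
  have "(\<lambda>j. d (w j)) \<in> L_inf A"
    unfolding L_inf_iff using wA d tail by fastforce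
  then obtain r where r: "T r = (\<lambda>j. d (w j))"
    using T by (metis imageE subsetD)
  \<comment> \<open>Surjectivity of \<pi>: row r supplies the letter of w at some position
    j.\<close>
  obtain j where "\<pi> j = r"
    using \<pi> by (metis bij_pointE)
  then have "w j = d (w j)"
    by (metis r w_def)
  then show False
    using d[of "w j"] wA by (metis rangeI subsetD)
qed

lemma infinite_L_inf_with_letter:
  assumes "c \<in> A" "d \<in> A" "c \<noteq> d"
  shows "infinite {w \<in> L_inf A. w j = c}"
proof -
  \<comment> \<open>The switch from c to d comes after position j, and at a different place for each
    k.\<close>
  define W where "W k = (\<lambda>m. if m < Suc (j + k) then c else d)" for k
  have "inj W"
  proof (rule linorder_injI)
    fix k l :: nat assume "k < l"
    then have "W k (Suc (j + k)) \<noteq> W l (Suc (j + k))"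
      using assms(3) by (simp add: W_def)
    then show "W k \<noteq> W l" by auto
  qed
  moreover have "range W \<subseteq> {w \<in> L_inf A. w j = c}"
  proof -
    have "W k \<in> L_inf A" for k
      unfolding L_inf_iff using assms
      by (auto simp: W_def intro!: exI[of _ d] exI[of _ "Suc (j + k)"])
    then show ?thesis by (auto simp: W_def)
  qed
  ultimately show ?thesis
    by (meson finite_subset finite_imageD infinite_UNIV_nat)
qed

lemma column_words_subset_Perm:
  assumes A: "\<And>a. a \<in> A \<Longrightarrow> \<exists>b\<in>A. b \<noteq> a" and T: "range T = L_inf A"
  shows "column_words T \<subseteq> Perm T"
proof
  fix c assume "c \<in> column_words T"
  then obtain k where c: "c = (\<lambda>i. T i k)"
    by (auto simp: column_words_def)
  have row: "range (T i) \<subseteq> A" "\<exists>a N. \<forall>j\<ge>N. T i j = a" for i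
    using T L_inf_iff[of "T i" A] by auto
  have col: "infinite {i. T i j = a}" if a: "a \<in> A" for a j
  proof
    \<comment> \<open>Finitely many rows would yield only finitely many words with letter a at
      position j, since every word of \<open>L_inf A\<close> is a row.\<close>
    assume "finite {i. T i j = a}"
    moreover have "{w \<in> L_inf A. w j = a} = T ` {i. T i j = a}"
      unfolding T[symmetric] by auto
    ultimately show False
      using infinite_L_inf_with_letter[of a A _ j] A[OF a] a by auto
  qed
  \<comment> \<open>Position j is related to row i when that row agrees with c at j.\<close>
  have "\<exists>\<pi>. bij \<pi> \<and> (\<forall>j. T (\<pi> j) j = c j)"
  proof (rule bij_in_infinite_relation)
    show "infinite {i. T i j = c j}" for j
      by (rule col) (use row(1) in \<open>auto simp: c\<close>)
    show "infinite {j. T i j = c j}" for i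
    proof -
      obtain a N where a: "\<And>j. j \<ge> N \<Longrightarrow> T i j = a"
        using row(2) by blast
      have "a \<in> A"
        using row(1)[of i] a[of N] by auto
      \<comment> \<open>Here \<open>col\<close> is applied to column k, whose word is c; beyond N,
        row i is constantly a, so it agrees with c wherever c has the letter a.\<close>
      then have "infinite ({j. c j = a} - {..<N})"
        unfolding c by (intro Diff_infinite_finite col) auto
      then show ?thesis
        by (rule infinite_super[rotated]) (use a in auto)
    qed
  qed
  then obtain \<pi> where "bij \<pi>" "c = (\<lambda>j. T (\<pi> j) j)"
    by auto
  then show "c \<in> Perm T"
    by (auto simp: Perm_def)
qed

theorem theorem6p1:
  fixes A :: "'a set" and s :: nat and T :: "'a tableau"
  assumes "s \<ge> 2"
    and "finite A" and "card A = s"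
    and "bij_betw T UNIV (L_inf A)"
  shows "(cantorian T \<and> Perm T \<inter> L_inf A = {}) \<and>
    (s = 2 \<longrightarrow> \<not> bi_cantorian T \<and> Perm T \<inter> (column_words T \<union> L_inf A) \<noteq> {})"
proof -
  have A: "\<exists>b\<in>A. b \<noteq> a" if "a \<in> A" for a
  proof (rule ccontr)
    assume "\<not> (\<exists>b\<in>A. b \<noteq> a)"
    then have "A = {a}" using that by blast
    then show False using assms(1,3) by simp
  qed
  have T: "range T = L_inf A"
    using assms(4) by (simp add: bij_betw_def)
  have disjoint: "Perm T \<inter> L_inf A = {}"
    by (rule Perm_disjoint_L_inf[OF A]) (simp_all add: T)
  have "column_words T \<subseteq> Perm T"
    by (rule column_words_subset_Perm[OF A T])
  moreover have "column_words T \<noteq> {}"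
    by (auto simp: column_words_def)
  ultimately have "Perm T \<inter> (column_words T \<union> L_inf A) \<noteq> {}"
    by blast
  with disjoint show ?thesis
    by (simp add: cantorian_def bi_cantorian_def row_words_eq_range T Un_commute)
qed

end
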